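(* Let $k\ge1$, $f\in C^\infty(\mathbb{R})$ and $t\in\mathbb{R}$. For all pairs $(a,b)\in\{0,1\}\times\{0,\ldots,k+1\}$, there exists a set $E_{a,b}\subset J^k(\mathbb{R})$ satisfying $$\dim_{\mathrm{Top}}J_{f,t}(E_{a,b})=a\quad\text{and}\quad\dim_{\mathrm{Top}}V_{f,t}(E_{a,b})=b.$$
   Context: Let $k\ge 1$ be an integer. The jet space Carnot group $J^k(\mathbb{R})$ is the set $\mathbb{R}^{k+2}$ (with its Euclidean topology), with points written $(x,u_k,\ldots,u_0)$, equipped with the group operation $(x,u_k,\ldots,u_0)\odot(y,v_k,\ldots,v_0)=(x+y,w_k,\ldots,w_0)$, where $w_k=u_k+v_k$ and $w_s=u_s+v_s+\sum_{j=s+1}^k u_j\frac{y^{j-s}}{(j-s)!}$ for $s=0,\ldots,k-1$; inverses $p^{-1}$ are with respect to $\odot$. $\dim_{\mathrm{Top}}$ is topological (inductive) dimension. For $f\in C^\infty(\mathbb{R})$ and $x\in\mathbb{R}$, $j^k_x(f):=j^k(f)(x):=(x,f^{(k)}(x),f^{(k-1)}(x),\ldots,f(x))\in J^k(\mathbb{R})$, and $\mathrm{im}(j^k(f)):=\{j^k_x(f):x\in\mathbb{R}\}$. For $t\in\mathbb{R}$, $\{x=t\}:=\{(x,u_k,\ldots,u_0)\in J^k(\mathbb{R}):x=t\}$. For $f\in C^\infty(\mathbb{R})$ and $t\in\mathbb{R}$, the vertical mapping $V_{f,t}:J^k(\mathbb{R})\to\{x=t\}$ and the horizontal mapping $J_{f,t}:J^k(\mathbb{R})\to\mathrm{im}(j^k(f))$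 are $V_{f,t}(x,u_k,\ldots,u_0):=(x,u_k,\ldots,u_0)\odot j^k_{x-t}(f)^{-1}$ and $J_{f,t}(x,u_k,\ldots,u_0):=j^k_{x-t}(f)$. *)

theory Defs
  imports "HOL-Analysis.Analysis" "HOL-Algebra.Group"
begin

text \<open>
  Points of \<open>J\<^sup>k(\<real>) = \<real>\<^bsup>k+2\<^esup>\<close>, written \<open>(x, u\<^sub>k, \<dots>, u\<^sub>0)\<close>, are the points \<open>p\<close> of
  \<^const>\<open>Euclidean_space\<close> \<open>(k + 2)\<close> with \<open>p s = u\<^sub>s\<close> for \<open>s \<le> k\<close> and \<open>p (k + 1) = x\<close>; all
  coordinates with index above \<open>k + 1\<close> are \<open>0\<close>.
\<close>

abbreviation jet_space :: "nat \<Rightarrow> (nat \<Rightarrow> real) set"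
  where "jet_space k \<equiv> topspace (Euclidean_space (k + 2))"

text \<open>For \<open>s = k\<close> the sum below is empty.\<close>

definition jet_mult :: "nat \<Rightarrow> (nat \<Rightarrow> real) \<Rightarrow> (nat \<Rightarrow> real) \<Rightarrow> (nat \<Rightarrow> real)"
  where "jet_mult k p q = (\<lambda>s.
    if s = k + 1 then p (k + 1) + q (k + 1)
    else if s \<le> k then p s + q s + (\<Sum>j = s + 1..k. p j * (q (k + 1) ^ (j - s) / fact (j - s)))
    else 0)"

definition jet_group :: "nat \<Rightarrow> (nat \<Rightarrow> real) monoid"
  where "jet_group k = \<lparr>carrier = jet_space k, mult = jet_mult k, one = (\<lambda>_. 0)\<rparr>"

definition smooth :: "(real \<Rightarrow> real) \<Rightarrow> bool"
  where "smooth f \<longleftrightarrow> (\<forall>n. (deriv ^^ n) f differentiable_on UNIV)"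

definition jet :: "nat \<Rightarrow> (real \<Rightarrow> real) \<Rightarrow> real \<Rightarrow> (nat \<Rightarrow> real)"
  where "jet k f x = (\<lambda>s. if s = k + 1 then x else if s \<le> k then (deriv ^^ s) f x else 0)"

definition vertical_map :: "nat \<Rightarrow> (real \<Rightarrow> real) \<Rightarrow> real \<Rightarrow> (nat \<Rightarrow> real) \<Rightarrow> (nat \<Rightarrow> real)"
  where "vertical_map k f t p =
    p \<otimes>\<^bsub>jet_group k\<^esub> inv\<^bsub>jet_group k\<^esub> (jet k f (p (k + 1) - t))"

definition horizontal_map :: "nat \<Rightarrow> (real \<Rightarrow> real) \<Rightarrow> real \<Rightarrow> (nat \<Rightarrow> real) \<Rightarrow> (nat \<Rightarrow> real)"
  where "horizontal_map k f t p = jet k f (p (k + 1) - t)"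

text \<open>
  The small inductive dimension, i.e. the least \<open>n\<close> with \<open>X dim_le n\<close>: it is \<open>-1\<close> exactly for
  the empty space, and \<open>\<infinity>\<close> (the infimum of the empty set) if there is no such \<open>n\<close>. All
  spaces considered here are separable metrizable, where it agrees with the large inductive and
  the covering dimension.
\<close>

definition top_dim :: "'a topology \<Rightarrow> ereal"
  where "top_dim X = Inf {ereal (of_int n) | n. X dim_le n}"

lemma jet_space_iff: "p \<in> jet_space k \<longleftrightarrow> (\<forall>i > k + 1. p i = 0)"
  by (auto simp: topspace_Euclidean_space)

lemma jet_mult_full_sum:
  assumes "s \<le> k"
  shows "jet_mult k p q s = q s + (\<Sum>j = s..k. p j * (q (k + 1) ^ (j - s) / fact (j - s)))"
proof -
  have "{s..k} = insert s {s + 1..k}" using assms by auto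
  then show ?thesis using assms by (simp add: jet_mult_def)
qed

lemma exp_binomial:
  fixes y z :: real
  shows "(y + z) ^ n / fact n = (\<Sum>i\<le>n. (y ^ i / fact i) * (z ^ (n - i) / fact (n - i)))"
proof -
  have "(y + z) ^ n / fact n = (\<Sum>i\<le>n. of_nat (n choose i) * y ^ i * z ^ (n - i) / fact n)"
    by (simp add: binomial_ring sum_divide_distrib)
  also have "\<dots> = (\<Sum>i\<le>n. (y ^ i / fact i) * (z ^ (n - i) / fact (n - i)))"
    by (intro sum.cong refl) (simp add: binomial_fact field_simps)
  finally show ?thesis .
qed

lemma jet_mult_assoc: "jet_mult k (jet_mult k p q) r = jet_mult k p (jet_mult k q r)"
proof
  fix s
  let ?P = "\<lambda>(y::real) n. y ^ n / fact n"
  let ?y = "q (k + 1)" and ?z = "r (k + 1)"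
  consider "s = k + 1" | "s > k + 1" | "s \<le> k" by linarith
  then show "jet_mult k (jet_mult k p q) r s = jet_mult k p (jet_mult k q r) s"
  proof cases
    case 3
    have top: "jet_mult k a b (k + 1) = a (k + 1) + b (k + 1)" for a b
      by (simp add: jet_mult_def)
    have "(\<Sum>j = s..k. jet_mult k p q j * ?P ?z (j - s))
        = (\<Sum>j = s..k. q j * ?P ?z (j - s) +
            (\<Sum>i = j..k. p i * ?P ?y (i - j) * ?P ?z (j - s)))"
      by (intro sum.cong refl)
         (simp only: jet_mult_full_sum distrib_right sum_distrib_right atLeastAtMost_iff)
    also have "\<dots> = (\<Sum>j = s..k. q j * ?P ?z (j - s)) +
        (\<Sum>j = s..k. \<Sum>i = j..k. p i * ?P ?y (i - j) * ?P ?z (j - s))"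
      by (rule sum.distrib)
    also have "(\<Sum>j = s..k. \<Sum>i = j..k. p i * ?P ?y (i - j) * ?P ?z (j - s)) =
        (\<Sum>i = s..k. \<Sum>j = s..i. p i * ?P ?y (i - j) * ?P ?z (j - s))"
      unfolding sum.Sigma[OF finite_atLeastAtMost ballI[OF finite_atLeastAtMost]]
      by (rule sum.reindex_bij_witness[of _ prod.swap prod.swap]) auto
    also have "\<dots> = (\<Sum>i = s..k. p i * ?P (?y + ?z) (i - s))"
    proof (intro sum.cong refl)
      fix i assume i: "i \<in> {s..k}"
      have "(\<Sum>j = s..i. p i * ?P ?y (i - j) * ?P ?z (j - s)) =
          (\<Sum>l\<le>i - s. p i * (?P ?y l * ?P ?z (i - s - l)))"
        using i
        by (intro sum.reindex_bij_witness[of _ "\<lambda>l. i - l" "\<lambda>j. i - j"]) auto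
      then show "(\<Sum>j = s..i. p i * ?P ?y (i - j) * ?P ?z (j - s)) =
          p i * ?P (?y + ?z) (i - s)"
        by (simp only: exp_binomial sum_distrib_left)
    qed
    finally show ?thesis
      using 3 by (simp only: jet_mult_full_sum top)
  qed (auto simp: jet_mult_def)
qed

function jet_inv :: "nat \<Rightarrow> (nat \<Rightarrow> real) \<Rightarrow> nat \<Rightarrow> real" where
  "jet_inv k p s = (if s = k + 1 then - p s else if s \<le> k then
     - p s - (\<Sum>j = s + 1..k. jet_inv k p j * (p (k + 1) ^ (j - s) / fact (j - s))) else 0)"
  by auto
termination by (relation "Wellfounded.measure (\<lambda>(k, p, s). k + 1 - s)") auto

declare jet_inv.simps [simp del]

lemma group_jet_group: "group (jet_group k)"
proof (rule groupI)
  fix p assume "p \<in> carrier (jet_group k)"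
  have "jet_mult k (jet_inv k p) p = (\<lambda>_. 0)"
  proof
    fix s show "jet_mult k (jet_inv k p) p s = 0"
      by (simp add: jet_mult_def jet_inv.simps[of k p s] jet_inv.simps[of k p "Suc k"])
  qed
  moreover have "jet_inv k p \<in> jet_space k"
    unfolding jet_space_iff by (simp add: jet_inv.simps)
  ultimately show "\<exists>q\<in>carrier (jet_group k). q \<otimes>\<^bsub>jet_group k\<^esub> p = \<one>\<^bsub>jet_group k\<^esub>"
    by (auto simp: jet_group_def)
next
  fix p assume "p \<in> carrier (jet_group k)"
  then show "\<one>\<^bsub>jet_group k\<^esub> \<otimes>\<^bsub>jet_group k\<^esub> p = p"
    by (auto simp: jet_group_def jet_space_iff jet_mult_def fun_eq_iff topspace_Euclidean_space)
qed (auto simp: jet_group_def jet_mult_assoc topspace_Euclidean_space, auto simp: jet_mult_def)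

lemma jet_in_jet_space: "jet k f x \<in> jet_space k"
  unfolding jet_space_iff by (simp add: jet_def)

lemma horizontal_map_in: "horizontal_map k f t p \<in> range (jet k f)"
  by (simp add: horizontal_map_def)

lemma vertical_map_in:
  assumes "p \<in> jet_space k"
  shows "vertical_map k f t p \<in> {q \<in> jet_space k. q (k + 1) = t}"
proof -
  interpret group "jet_group k" by (rule group_jet_group)
  have carr: "carrier (jet_group k) = jet_space k"
    by (simp add: jet_group_def)
  have top: "(a \<otimes>\<^bsub>jet_group k\<^esub> b) (k + 1) = a (k + 1) + b (k + 1)" for a b
    by (simp add: jet_group_def jet_mult_def)
  let ?j = "jet k f (p (k + 1) - t)"
  have j: "?j \<in> carrier (jet_group k)"
    using jet_in_jet_space carr by simp
  then have "vertical_map k f t p \<otimes>\<^bsub>jet_group k\<^esub> ?j = p"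
    using assms carr m_assoc[OF _ inv_closed[OF j] j] by (simp only: vertical_map_def l_inv r_one)
  then have "vertical_map k f t p (k + 1) + ?j (k + 1) = p (k + 1)"
    using top by metis
  moreover have "vertical_map k f t p \<in> jet_space k"
    using assms j carr unfolding vertical_map_def by (metis inv_closed m_closed)
  ultimately show ?thesis by (simp add: jet_def)
qed

lemma top_dim_eq_int_iff:
  "top_dim X = ereal (of_int n) \<longleftrightarrow> X dim_le n \<and> \<not> X dim_le (n - 1)"
proof (cases "\<exists>m. X dim_le m")
  case False
  then show ?thesis by (simp add: top_dim_def top_ereal_def)
next
  case True
  then obtain m0 where m0: "X dim_le m0" by blast
  define m where "m = (LEAST i. X dim_le (int i - 1))"
  have bound: "-1 \<le> i" if "X dim_le i" for i
    using that by (rule dimension_le_bound)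
  have ex: "X dim_le (int (nat (m0 + 1)) - 1)"
    using m0 bound[OF m0] by simp
  have least: "X dim_le (int m - 1)"
    unfolding m_def using ex by (rule LeastI)
  have le: "int m - 1 \<le> i" if "X dim_le i" for i
  proof -
    have "X dim_le (int (nat (i + 1)) - 1)"
      using that bound[OF that] by simp
    then have "m \<le> nat (i + 1)"
      unfolding m_def by (rule Least_le)
    then show ?thesis using bound[OF that] by linarith
  qed
  have dim: "top_dim X = ereal (of_int (int m - 1))"
    unfolding top_dim_def
  proof (rule antisym)
    show "Inf {ereal (of_int n) | n. X dim_le n} \<le> ereal (of_int (int m - 1))"
      using least by (blast intro: Inf_lower)
    show "ereal (of_int (int m - 1)) \<le> Inf {ereal (of_int n) | n. X dim_le n}"
      using le by (intro Inf_greatest) (auto simp only: ereal_less_eq of_int_le_iff mem_Collect_eq)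
  qed
  have "top_dim X = ereal (of_int n) \<longleftrightarrow> int m - 1 = n"
    unfolding dim by (simp only: ereal.inject of_int_eq_iff)
  also have "\<dots> \<longleftrightarrow> X dim_le n \<and> \<not> X dim_le (n - 1)"
  proof
    assume "int m - 1 = n"
    then show "X dim_le n \<and> \<not> X dim_le (n - 1)" using least le[of "n - 1"] by auto
  next
    assume *: "X dim_le n \<and> \<not> X dim_le (n - 1)"
    have "\<not> int m - 1 \<le> n - 1" using * least dimension_le_mono by blast
    then show "int m - 1 = n" using * le[of n] by linarith
  qed
  finally show ?thesis .
qed

end

theory Submission
  imports Defs
begin

text \<open>
  Every point of the jet space is \<open>v \<odot> j\<^sup>k\<^sub>x(f)\<close> for unique \<open>v\<close> in the plane \<open>{x = t}\<close> and
  \<open>x \<in> \<real>\<close>, and \<open>V\<close> and \<open>J\<close> return the two factors. So \<open>E\<close> can be a product of a set of vertical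
  factors of dimension \<open>b\<close> and a set of horizontal factors of dimension \<open>a\<close>, chosen independently.
  For the former take a \<open>b\<close>-dimensional unit cube in \<open>{x = t}\<close>, a copy of \<open>\<real>\<^bsup>k+1\<^esup>\<close>; for the
  latter a point or the segment of the jet curve over \<open>[0, 1]\<close>, which is homeomorphic to a
  1-dimensional cube.

  What has to be proved is that the \<open>n\<close>-dimensional cube has small inductive dimension \<open>n\<close>, for
  every natural number \<open>n\<close>.

  For the upper bound (\<open>dim_le_few_coordinates_outside_countable\<close>) use boxes whose corner
  coordinates avoid a countable set \<open>Z\<close>, and induct on the number of coordinates of a point that
  lie outside \<open>Z\<close> while \<open>Z\<close> grows by the corners.

  For the lower bound, pass from inductive dimension to orders of covers: if a compact set has
  inductive dimension at most \<open>n - 1\<close>, each finite open cover has a refinement in which no point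
  lies in more than \<open>n\<close> sets (\<open>dim_le_imp_cover_order_le\<close>). The gain is that covers have an easy
  sum theorem (\<open>cover_order_le_Un\<close>), which is needed because the frontier of a finite union is
  only covered by the union of the frontiers. Such a refinement can be regrouped into \<open>n\<close> families
  of disjoint open sets (\<open>cover_order_le_disjoint_families\<close>). If the sets are small, the \<open>m\<close>-th
  family splits into two disjoint open sets, one off each of the faces of the cube orthogonal to
  the direction \<open>m\<close>, and Kuhn's lemma, the combinatorial core of Brouwer's fixed point
  theorem, shows that \<open>n\<close> such pairs cannot cover the cube (\<open>cube_no_separating_cover\<close>).
\<close>

section \<open>Finite open covers and inductive dimension\<close>

text \<open>
  Covering dimension at most \<open>n - 1\<close>, with covers of \<open>S\<close> by open sets of the whole space. The
  bound is put on the order \<open>n\<close> and not on the dimension, so that the empty set has \<open>n = 0\<close> and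
  all arithmetic stays in the natural numbers. The refinement keeps the index of each set; this
  is what makes the sum theorem below short.
\<close>

definition cover_order_le :: "'a::metric_space set \<Rightarrow> nat \<Rightarrow> bool" where
  "cover_order_le S n \<longleftrightarrow>
    (\<forall>(N::nat) U. (\<forall>i<N. open (U i)) \<and> S \<subseteq> (\<Union>i<N. U i) \<longrightarrow>
      (\<exists>V. (\<forall>i<N. open (V i) \<and> V i \<subseteq> U i) \<and> S \<subseteq> (\<Union>i<N. V i) \<and>
        (\<forall>x\<in>S. card {i. i < N \<and> x \<in> V i} \<le> n)))"

lemma cover_order_leD:
  fixes N :: nat
  assumes "cover_order_le S n" "\<And>i. i < N \<Longrightarrow> open (U i)" "S \<subseteq> (\<Union>i<N. U i)"
  obtains V where "\<And>i. i < N \<Longrightarrow> open (V i)" "\<And>i. i < N \<Longrightarrow> V i \<subseteq> U i" "S \<subseteq> (\<Union>i<N. V i)"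
    "\<And>x. x \<in> S \<Longrightarrow> card {i. i < N \<and> x \<in> V i} \<le> n"
proof -
  have "\<exists>V. (\<forall>i<N. open (V i) \<and> V i \<subseteq> U i) \<and> S \<subseteq> (\<Union>i<N. V i) \<and>
        (\<forall>x\<in>S. card {i. i < N \<and> x \<in> V i} \<le> n)"
    using assms unfolding cover_order_le_def by blast
  then show thesis using that by blast
qed

lemma cover_order_le_empty: "cover_order_le {} n"
  unfolding cover_order_le_def by auto

text \<open>
  A refinement over \<open>S\<close> extends to one over \<open>S \<union> T\<close> by leaving the cover as it is outside the
  closed set \<open>S\<close>. Refining the result over \<open>T\<close> in the same way only shrinks the sets further, so
  the order over \<open>S\<close> stays bounded.
\<close>

lemma cover_order_le_Un:
  assumes S: "cover_order_le S n" "closed S" and T: "cover_order_le T n" "closed T"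
  shows "cover_order_le (S \<union> T) n"
  unfolding cover_order_le_def
proof (intro allI impI, elim conjE)
  fix N :: nat and U :: "nat \<Rightarrow> 'a set"
  assume oU: "\<forall>i<N. open (U i)" and cU: "S \<union> T \<subseteq> (\<Union>i<N. U i)"
  obtain V where V: "\<And>i. i < N \<Longrightarrow> open (V i)" "\<And>i. i < N \<Longrightarrow> V i \<subseteq> U i" "S \<subseteq> (\<Union>i<N. V i)"
    "\<And>x. x \<in> S \<Longrightarrow> card {i. i < N \<and> x \<in> V i} \<le> n"
    using cover_order_leD[OF S(1), of N U] oU cU by auto
  define U' where "U' = (\<lambda>i. V i \<union> (U i - S))"
  have oU': "open (U' i)" if "i < N" for i
    using that V(1) oU S(2) unfolding U'_def by (auto intro: open_Diff)
  have cU': "S \<union> T \<subseteq> (\<Union>i<N. U' i)"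
    using cU V(3) unfolding U'_def by fastforce
  obtain W where W: "\<And>i. i < N \<Longrightarrow> open (W i)" "\<And>i. i < N \<Longrightarrow> W i \<subseteq> U' i" "T \<subseteq> (\<Union>i<N. W i)"
    "\<And>x. x \<in> T \<Longrightarrow> card {i. i < N \<and> x \<in> W i} \<le> n"
    using cover_order_leD[OF T(1), of N U'] oU' cU' by auto
  define W' where "W' = (\<lambda>i. W i \<union> (U' i - T))"
  have "card {i. i < N \<and> x \<in> W' i} \<le> n" if "x \<in> S \<union> T" for x
  proof (cases "x \<in> T")
    case True
    then have "{i. i < N \<and> x \<in> W' i} = {i. i < N \<and> x \<in> W i}" by (auto simp: W'_def)
    then show ?thesis using W(4) True by simp
  next
    case False
    then have x: "x \<in> S" using that by simp
    have "{i. i < N \<and> x \<in> W' i} \<subseteq> {i. i < N \<and> x \<in> V i}"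
      using x W(2) by (auto simp: W'_def U'_def)
    then have "card {i. i < N \<and> x \<in> W' i} \<le> card {i. i < N \<and> x \<in> V i}"
      by (intro card_mono) auto
    then show ?thesis using V(4)[OF x] by simp
  qed
  moreover have "\<forall>i<N. open (W' i) \<and> W' i \<subseteq> U i"
    using W(1,2) V(2) oU' T(2) unfolding W'_def U'_def by (fastforce intro: open_Diff)
  moreover have "S \<union> T \<subseteq> (\<Union>i<N. W' i)"
    using cU' W(3) unfolding W'_def by fastforce
  ultimately show "\<exists>V. (\<forall>i<N. open (V i) \<and> V i \<subseteq> U i) \<and> S \<union> T \<subseteq> (\<Union>i<N. V i) \<and>
        (\<forall>x\<in>S \<union> T. card {i. i < N \<and> x \<in> V i} \<le> n)"
    by blast
qed

lemma cover_order_le_UN: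
  assumes "finite J" "\<And>j. j \<in> J \<Longrightarrow> cover_order_le (S j) n" "\<And>j. j \<in> J \<Longrightarrow> closed (S j)"
  shows "cover_order_le (\<Union>j\<in>J. S j) n"
  using assms
proof (induction J rule: finite_induct)
  case empty
  then show ?case by (simp add: cover_order_le_empty subtopology_trivial_iff)
next
  case (insert j J)
  then show ?case by (simp add: cover_order_le_Un closed_UN)
qed

text \<open>
  An order bound on \<open>F\<close> holds on a whole neighbourhood of \<open>F\<close> after shrinking: a point close to
  \<open>F\<close> inherits its memberships from a single point of \<open>F\<close>. Halving the radii gives that single
  point, namely the centre of the smallest of the balls that contain the given point.
\<close>

lemma shrink_to_neighbourhood_order:
  fixes F :: "'a::metric_space set" and W :: "nat \<Rightarrow> 'a set"
  assumes oW: "\<And>i. i < N \<Longrightarrow> open (W i)"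
    and ord: "\<And>x. x \<in> F \<Longrightarrow> card {i. i < N \<and> x \<in> W i} \<le> n"
  obtains V where "\<And>i. i < N \<Longrightarrow> open (V i)" "\<And>i. i < N \<Longrightarrow> V i \<subseteq> W i"
    "\<And>i. i < N \<Longrightarrow> F \<inter> W i \<subseteq> V i" "\<And>x. card {i. i < N \<and> x \<in> V i} \<le> n"
proof
  define V where "V = (\<lambda>i. \<Union>{ball y (e / 2) | y e. y \<in> F \<and> e > 0 \<and> ball y e \<subseteq> W i})"
  show "open (V i)" for i
    unfolding V_def by (intro open_Union) auto
  show "V i \<subseteq> W i" for i
    unfolding V_def by fastforce
  show "F \<inter> W i \<subseteq> V i" if i: "i < N" for i
  proof
    fix y assume y: "y \<in> F \<inter> W i"
    then obtain e where e: "e > 0" "ball y e \<subseteq> W i"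
      using oW[OF i] by (meson IntD2 openE)
    then have "y \<in> ball y (e / 2)" by simp
    then show "y \<in> V i" unfolding V_def using y e by blast
  qed
  show "card {i. i < N \<and> x \<in> V i} \<le> n" for x
  proof (cases "{i. i < N \<and> x \<in> V i} = {}")
    case True
    then show ?thesis by (metis card.empty zero_le)
  next
    case False
    let ?J = "{i. i < N \<and> x \<in> V i}"
    have "\<exists>y e. y \<in> F \<and> e > 0 \<and> ball y e \<subseteq> W i \<and> dist y x < e / 2" if "i \<in> ?J" for i
    proof -
      have "x \<in> V i" using that by simp
      then show ?thesis unfolding V_def Union_iff mem_Collect_eq using mem_ball by blast
    qed
    then obtain y e where ye: "\<And>i. i \<in> ?J \<Longrightarrow> y i \<in> F \<and> e i > 0 \<and> ball (y i) (e i) \<subseteq> W i \<and> dist (y i) x < e i / 2"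
      by metis
    define m where "m = arg_min_on e ?J"
    have m: "m \<in> ?J" "\<And>i. i \<in> ?J \<Longrightarrow> e m \<le> e i"
      using arg_min_if_finite(1)[of ?J e] arg_min_least[of ?J _ e] False unfolding m_def by auto
    have "?J \<subseteq> {i. i < N \<and> y m \<in> W i}"
    proof
      fix i assume i: "i \<in> ?J"
      have "dist (y i) (y m) \<le> dist (y i) x + dist (y m) x" by (rule dist_triangle2)
      also have "\<dots> < e i" using ye[OF i] ye[OF m(1)] m(2)[OF i] by linarith
      finally have "y m \<in> ball (y i) (e i)" by simp
      then show "i \<in> {i. i < N \<and> y m \<in> W i}" using ye[OF i] i by blast
    qed
    then have "card ?J \<le> card {i. i < N \<and> y m \<in> W i}"
      by (intro card_mono) auto
    then show ?thesis using ord[of "y m"] ye[OF m(1)] by linarith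
  qed
qed

text \<open>The recursion for the small inductive dimension, in terms of closures in the ambient space.\<close>

lemma dim_le_subset_iff:
  "top_of_set S dim_le n \<longleftrightarrow> -1 \<le> n \<and>
    (\<forall>V a. open V \<and> a \<in> V \<and> a \<in> S \<longrightarrow>
      (\<exists>U. a \<in> U \<and> U \<subseteq> V \<and> open U \<and> top_of_set (S \<inter> closure (S \<inter> U) - U) dim_le (n - 1)))"
proof -
  have "top_of_set S frontier_of (S \<inter> U) = S \<inter> closure (S \<inter> U) - U" if "open U" for U
  proof -
    have "openin (top_of_set S) (S \<inter> U)" using that by (simp add: openin_open_Int)
    then have "top_of_set S interior_of (S \<inter> U) = S \<inter> U" by (rule interior_of_openin)
    moreover have "top_of_set S closure_of (S \<inter> U) = S \<inter> closure (S \<inter> U)"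
      by (simp add: closure_of_subtopology)
    ultimately show ?thesis unfolding frontier_of_def by auto
  qed
  then show ?thesis
    unfolding dimension_le_eq_subtopology[of euclidean S n] open_openin[symmetric]
    by (metis (no_types, lifting))
qed

text \<open>
  Finitely many small open sets \<open>P j\<close> with low-dimensional frontiers cover the compact set \<open>S\<close>.
  Off the union \<open>F\<close> of the frontiers, \<open>S\<close> falls into disjoint open pieces, each inside one \<open>P j\<close>,
  and these pieces contribute only one to the order. On \<open>F\<close> the sum theorem and induction give a
  refinement of order \<open>n\<close>, which survives on a neighbourhood of \<open>F\<close>.
\<close>

lemma dim_le_imp_cover_order_le:
  assumes "compact S" "top_of_set S dim_le (int n - 1)"
  shows "cover_order_le S n"
  using assms
proof (induction n arbitrary: S)
  case 0
  then show ?case by (simp add: cover_order_le_empty subtopology_trivial_iff)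
next
  case (Suc n)
  show ?case
    unfolding cover_order_le_def
  proof (intro allI impI, elim conjE)
    fix N :: nat and U :: "nat \<Rightarrow> 'a set"
    assume oU: "\<forall>i<N. open (U i)" and cU: "S \<subseteq> (\<Union>i<N. U i)"
    have "\<exists>i P. i < N \<and> a \<in> P \<and> P \<subseteq> U i \<and> open P \<and> top_of_set (S \<inter> closure (S \<inter> P) - P) dim_le (int n - 1)"
      if a: "a \<in> S" for a
    proof -
      obtain i where i: "i < N" "a \<in> U i" using cU a by blast
      then have "\<exists>P. a \<in> P \<and> P \<subseteq> U i \<and> open P \<and> top_of_set (S \<inter> closure (S \<inter> P) - P) dim_le (int n - 1)"
        using Suc.prems(2) a oU dim_le_subset_iff[of S "int (Suc n) - 1"] by auto
      then show ?thesis using i by blast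
    qed
    then obtain ix P where P: "\<And>a. a \<in> S \<Longrightarrow> ix a < N \<and> a \<in> P a \<and> P a \<subseteq> U (ix a) \<and> open (P a) \<and>
        top_of_set (S \<inter> closure (S \<inter> P a) - P a) dim_le (int n - 1)"
      by metis
    have "S \<subseteq> (\<Union>a\<in>S. P a)" using P by blast
    then obtain D where D: "D \<subseteq> S" "finite D" "S \<subseteq> (\<Union>a\<in>D. P a)"
      using compactE_image[OF Suc.prems(1), of S P] P by metis
    obtain r :: nat and p where p: "D = p ` {j. j < r}"
      using finite_imp_nat_seg_image_inj_on[OF D(2)] by blast
    have pS: "p j \<in> S" if "j < r" for j using p D(1) that by blast
    have cov: "\<exists>j<r. x \<in> P (p j)" if "x \<in> S" for x using D(3) that p by auto
    define F where "F = (\<Union>j\<in>{..<r}. S \<inter> closure (S \<inter> P (p j)) - P (p j))"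
    have "cover_order_le F n"
      unfolding F_def
    proof (rule cover_order_le_UN)
      fix j assume "j \<in> {..<r}"
      then have j: "p j \<in> S" using pS by simp
      have "S \<inter> closure (S \<inter> P (p j)) - P (p j) = S \<inter> (closure (S \<inter> P (p j)) \<inter> - P (p j))" by blast
      then have c: "compact (S \<inter> closure (S \<inter> P (p j)) - P (p j))"
        using compact_Int_closed[OF Suc.prems(1), of "closure (S \<inter> P (p j)) \<inter> - P (p j)"] P[OF j]
        by (auto simp: closed_Int closed_Compl)
      then show "closed (S \<inter> closure (S \<inter> P (p j)) - P (p j))" by (rule compact_imp_closed)
      show "cover_order_le (S \<inter> closure (S \<inter> P (p j)) - P (p j)) n"
        using Suc.IH[OF c] P[OF j] by blast
    qed simp
    moreover have "F \<subseteq> (\<Union>i<N. U i)" using cU unfolding F_def by blast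
    ultimately obtain W where W: "\<And>i. i < N \<Longrightarrow> open (W i)" "\<And>i. i < N \<Longrightarrow> W i \<subseteq> U i" "F \<subseteq> (\<Union>i<N. W i)"
      "\<And>x. x \<in> F \<Longrightarrow> card {i. i < N \<and> x \<in> W i} \<le> n"
      using cover_order_leD[of F n N U] oU by auto
    obtain W' where W': "\<And>i. i < N \<Longrightarrow> open (W' i)" "\<And>i. i < N \<Longrightarrow> W' i \<subseteq> W i"
      "\<And>i. i < N \<Longrightarrow> F \<inter> W i \<subseteq> W' i" "\<And>x. card {i. i < N \<and> x \<in> W' i} \<le> n"
      using shrink_to_neighbourhood_order[of N W F n] W by blast
    define G where "G = (\<lambda>j. P (p j) - (\<Union>l<j. closure (S \<inter> P (p l))))"
    have G_disj: "j = l" if "x \<in> S" "x \<in> G j" "x \<in> G l" for x j l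
    proof (rule ccontr)
      assume "j \<noteq> l"
      moreover have "False" if "a < b" "x \<in> G a" "x \<in> G b" for a b
      proof -
        have "x \<in> closure (S \<inter> P (p a))"
          using that(2) \<open>x \<in> S\<close> closure_subset[of "S \<inter> P (p a)"] unfolding G_def by blast
        then show False using that(1,3) unfolding G_def by blast
      qed
      ultimately show False using that by (meson linorder_neqE_nat)
    qed
    have G_cov: "\<exists>j<r. x \<in> G j" if x: "x \<in> S" "x \<notin> F" for x
    proof -
      define j where "j = (LEAST j. j < r \<and> x \<in> P (p j))"
      have j: "j < r" "x \<in> P (p j)"
        using LeastI_ex[OF cov[OF x(1)]] unfolding j_def by auto
      have "x \<notin> P (p l)" if "l < j" for l
        using not_less_Least[of l "\<lambda>j. j < r \<and> x \<in> P (p j)"] that j unfolding j_def[symmetric] by auto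
      then have "x \<notin> closure (S \<inter> P (p l))" if "l < j" for l
        using x j(1) that unfolding F_def by auto
      then show ?thesis using j unfolding G_def by blast
    qed
    define V where "V = (\<lambda>i. W' i \<union> (\<Union>j\<in>{j. j < r \<and> ix (p j) = i}. G j))"
    have oG: "open (G j)" if "j < r" for j
      using P[OF pS[OF that]] unfolding G_def by (auto intro!: open_Diff closed_UN)
    have "card {i. i < N \<and> x \<in> V i} \<le> Suc n" if x: "x \<in> S" for x
    proof -
      obtain b where b: "\<And>j. x \<in> G j \<Longrightarrow> j = b" using G_disj[OF x] by metis
      have "{i. i < N \<and> x \<in> V i} \<subseteq> insert (ix (p b)) {i. i < N \<and> x \<in> W' i}"
        using b unfolding V_def by auto
      then have "card {i. i < N \<and> x \<in> V i} \<le> card (insert (ix (p b)) {i. i < N \<and> x \<in> W' i})"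
        by (intro card_mono) auto
      also have "\<dots> \<le> Suc (card {i. i < N \<and> x \<in> W' i})" by (rule card_insert_le_m1) auto
      finally show ?thesis using W'(4)[of x] by linarith
    qed
    moreover have "open (V i) \<and> V i \<subseteq> U i" if i: "i < N" for i
    proof
      show "open (V i)" unfolding V_def using W'(1)[OF i] oG by auto
      have "G j \<subseteq> U (ix (p j))" if "j < r" for j
        using P[OF pS[OF that]] unfolding G_def by blast
      then show "V i \<subseteq> U i" unfolding V_def using W'(2)[OF i] W(2)[OF i] by auto
    qed
    moreover have "S \<subseteq> (\<Union>i<N. V i)"
    proof
      fix x assume x: "x \<in> S"
      show "x \<in> (\<Union>i<N. V i)"
      proof (cases "x \<in> F")
        case True
        then show ?thesis using W(3) W'(3) unfolding V_def by blast
      next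
        case False
        then obtain j where "j < r" "x \<in> G j" using G_cov x by blast
        then show ?thesis using P[OF pS] unfolding V_def by blast
      qed
    qed
    ultimately show "\<exists>V. (\<forall>i<N. open (V i) \<and> V i \<subseteq> U i) \<and> S \<subseteq> (\<Union>i<N. V i) \<and>
        (\<forall>x\<in>S. card {i. i < N \<and> x \<in> V i} \<le> Suc n)"
      by blast
  qed
qed

section \<open>The dimension of a cube is at least its number of coordinates\<close>

text \<open>
  Let \<open>\<phi> i\<close> be continuous, positive on the \<open>i\<close>-th set of a refinement and zero elsewhere. Among
  the sets \<open>D I\<close> of points where each \<open>\<phi> i\<close> with \<open>i \<in> I\<close> is positive and exceeds all \<open>\<phi> j\<close> with
  \<open>j \<notin> I\<close>, those with \<open>card I\<close> fixed are disjoint. As at most \<open>n\<close> of the \<open>\<phi> i\<close> are positive at a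
  point, the cardinalities \<open>1, \<dots>, n\<close> suffice for a cover.
\<close>

lemma cover_order_le_disjoint_families:
  fixes S :: "'a::metric_space set" and N :: nat
  assumes "cover_order_le S n" "\<And>i. i < N \<Longrightarrow> open (U i)" "S \<subseteq> (\<Union>i<N. U i)"
  obtains \<D> :: "nat \<Rightarrow> 'a set set" where
    "\<And>m E. E \<in> \<D> m \<Longrightarrow> open E \<and> (\<exists>i<N. E \<subseteq> U i)"
    "\<And>m. disjoint (\<D> m)" "S \<subseteq> (\<Union>m<n. \<Union>(\<D> m))"
proof -
  obtain V where V: "\<And>i. i < N \<Longrightarrow> open (V i)" "\<And>i. i < N \<Longrightarrow> V i \<subseteq> U i" "S \<subseteq> (\<Union>i<N. V i)"
    "\<And>x. x \<in> S \<Longrightarrow> card {i. i < N \<and> x \<in> V i} \<le> n"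
    using cover_order_leD[of S n N U] assms by blast
  \<comment> \<open>The distance to the empty set is 0 by convention, hence the separate case.\<close>
  define \<phi> where "\<phi> = (\<lambda>i x. if V i = UNIV then 1 else infdist x (- V i))"
  have cont: "continuous_on UNIV (\<phi> i)" for i
    unfolding \<phi>_def by (cases "V i = UNIV") (auto intro!: continuous_intros)
  have pos: "0 < \<phi> i x \<longleftrightarrow> x \<in> V i" if "i < N" for i x
  proof (cases "V i = UNIV")
    case False
    then have "x \<in> - V i \<longleftrightarrow> infdist x (- V i) = 0"
      using V(1)[OF that] by (intro in_closed_iff_infdist_zero) auto
    then show ?thesis using False infdist_nonneg[of x "- V i"] unfolding \<phi>_def by force
  qed (simp add: \<phi>_def)
  have nonneg: "0 \<le> \<phi> i x" for i x
    unfolding \<phi>_def by (simp add: infdist_nonneg)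
  define D where "D = (\<lambda>I. (\<Inter>i\<in>I. {x. 0 < \<phi> i x}) \<inter> (\<Inter>i\<in>I. \<Inter>j\<in>{..<N} - I. {x. \<phi> j x < \<phi> i x}))"
  define \<D> where "\<D> = (\<lambda>m. {D I | I. I \<subseteq> {..<N} \<and> card I = Suc m})"
  show thesis
  proof
    fix m E assume "E \<in> \<D> m"
    then obtain I where I: "E = D I" "I \<subseteq> {..<N}" "card I = Suc m" unfolding \<D>_def by blast
    have fI: "finite I" using I(2) finite_subset by blast
    then have "open (D I)"
      unfolding D_def by (intro open_Int open_INT ballI open_Collect_less cont continuous_on_const) auto
    moreover obtain i where i: "i \<in> I" using I(3) by fastforce
    moreover have "D I \<subseteq> V i" using i I(2) pos[of i] unfolding D_def by auto
    ultimately show "open E \<and> (\<exists>i<N. E \<subseteq> U i)" using I V(2) by (metis lessThan_iff subset_iff)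
  next
    fix m
    have "I = J" if x: "x \<in> D I" "x \<in> D J"
      and IJ: "I \<subseteq> {..<N}" "J \<subseteq> {..<N}" "card I = Suc m" "card J = Suc m" for x I J
    proof (rule ccontr)
      assume "I \<noteq> J"
      have f: "finite I" "finite J" using IJ(1,2) finite_subset by blast+
      have "\<not> I \<subseteq> J" "\<not> J \<subseteq> I" using \<open>I \<noteq> J\<close> IJ f card_subset_eq by metis+
      then obtain i j where ij: "i \<in> I" "i \<notin> J" "j \<in> J" "j \<notin> I" by blast
      then have "\<phi> j x < \<phi> i x" "\<phi> i x < \<phi> j x" using x IJ(1,2) unfolding D_def by auto
      then show False by simp
    qed
    then show "disjoint (\<D> m)"
      unfolding \<D>_def pairwise_def disjnt_def by blast
  next
    show "S \<subseteq> (\<Union>m<n. \<Union>(\<D> m))"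
    proof
      fix x assume x: "x \<in> S"
      let ?I = "{i. i < N \<and> x \<in> V i}"
      have "?I \<noteq> {}" using V(3) x by blast
      then have "card ?I > 0" by (simp add: card_gt_0_iff)
      then obtain m where m: "card ?I = Suc m" using gr0_implies_Suc by blast
      have "\<phi> j x < \<phi> i x" if "i \<in> ?I" "j \<in> {..<N} - ?I" for i j
      proof -
        have "\<phi> j x = 0" using pos[of j x] nonneg[of j x] that by force
        then show ?thesis using pos[of i x] that by simp
      qed
      then have "x \<in> D ?I" unfolding D_def using pos by auto
      then have "x \<in> \<Union>(\<D> m)" unfolding \<D>_def using m by blast
      moreover have "m < n" using V(4)[OF x] m by simp
      ultimately show "x \<in> (\<Union>m<n. \<Union>(\<D> m))" by blast
    qed
  qed
qed

definition cube :: "nat \<Rightarrow> (nat \<Rightarrow> real) \<Rightarrow> (nat \<Rightarrow> real) set" where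
  "cube n c = {x. (\<forall>i<n. 0 \<le> x i \<and> x i \<le> 1) \<and> (\<forall>i\<ge>n. x i = c i)}"

lemma compact_cube: "compact (cube n c)"
proof -
  have "cube n c = PiE UNIV (\<lambda>i. if i < n then {0..1} else {c i})"
  proof (rule Set.set_eqI)
    fix x :: "nat \<Rightarrow> real"
    have "x \<in> cube n c \<longleftrightarrow> (\<forall>i. if i < n then 0 \<le> x i \<and> x i \<le> 1 else x i = c i)"
      unfolding cube_def by (auto simp: not_less)
    also have "\<dots> \<longleftrightarrow> (\<forall>i. x i \<in> (if i < n then {0..1} else {c i}))"
      by (intro iff_allI) simp
    finally show "x \<in> cube n c \<longleftrightarrow> x \<in> PiE UNIV (\<lambda>i. if i < n then {0..1} else {c i})"
      by (simp add: PiE_iff)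
  qed
  moreover have "compactin euclidean (PiE UNIV (\<lambda>i. if i < n then {0..1} else {c i}))"
    unfolding euclidean_product_topology[symmetric] compactin_PiE by auto
  ultimately show ?thesis by simp
qed

lemma cube_nonempty: "cube n c \<noteq> {}"
proof -
  have "(\<lambda>i. if i < n then 0 else c i) \<in> cube n c" unfolding cube_def by simp
  then show ?thesis by blast
qed

lemma dist_fun_le:
  fixes x y :: "'a::countable \<Rightarrow> 'b::metric_space"
  assumes "\<And>i. dist (x i) (y i) \<le> e"
  shows "dist x y \<le> 2 * e"
proof -
  have s: "summable (\<lambda>n. (1/2::real)^n * min (dist (x (from_nat n)) (y (from_nat n))) 1)"
    by (rule summable_comparison_test'[of "\<lambda>n. (1/2)^n"]) (auto simp: summable_geometric_iff)
  have g: "(\<lambda>n. (1/2::real)^n * e) sums (2 * e)"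
    using sums_mult2[OF geometric_sums[of "1/2::real"], of e] by simp
  have "dist x y \<le> (\<Sum>n. (1/2)^n * e)"
    unfolding dist_fun_def using assms
    by (intro suminf_le[OF _ s sums_summable[OF g]] mult_left_mono min.coboundedI1) auto
  then show ?thesis using sums_unique[OF g] by simp
qed

text \<open>
  A combinatorial form of the Poincare--Miranda theorem. Label a grid point in direction \<open>m\<close>
  by 0 on \<open>W m\<close> and by 1 on \<open>R m\<close>. Kuhn's lemma yields a grid cell whose labels vary in every
  direction, whereas by compactness a cell of a fine grid lies in a single set of the cover,
  where the corresponding label is constant.
\<close>

lemma cube_no_separating_cover:
  assumes oW: "\<And>m. m < n \<Longrightarrow> open (W m)" and oR: "\<And>m. m < n \<Longrightarrow> open (R m)"
    and disj: "\<And>m. m < n \<Longrightarrow> W m \<inter> R m \<inter> cube n c = {}"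
    and W1: "\<And>m x. m < n \<Longrightarrow> x \<in> W m \<inter> cube n c \<Longrightarrow> x m \<noteq> 1"
    and R0: "\<And>m x. m < n \<Longrightarrow> x \<in> R m \<inter> cube n c \<Longrightarrow> x m \<noteq> 0"
    and cov: "cube n c \<subseteq> (\<Union>m<n. W m \<union> R m)"
  shows False
proof -
  define \<G> where "\<G> = W ` {..<n} \<union> R ` {..<n}"
  have "\<Union>\<G> = (\<Union>m<n. W m \<union> R m)" unfolding \<G>_def by auto
  then have "cube n c \<subseteq> \<Union>\<G>" using cov by simp
  moreover have "\<And>G. G \<in> \<G> \<Longrightarrow> open G" using oW oR unfolding \<G>_def by auto
  ultimately obtain \<epsilon> where \<epsilon>: "\<epsilon> > 0" "\<And>x. x \<in> cube n c \<Longrightarrow> \<exists>G\<in>\<G>. ball x \<epsilon> \<subseteq> G"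
    using Heine_Borel_lemma[OF compact_cube] by metis
  obtain p :: nat where p: "p > 0" "2 * (1 / real p) < \<epsilon>"
  proof -
    obtain q where "inverse (real (Suc q)) < \<epsilon> / 2" using reals_Archimedean \<epsilon>(1) half_gt_zero by blast
    then show thesis using that[of "Suc q"] by (simp add: inverse_eq_divide)
  qed
  define pt where "pt = (\<lambda>(z::nat \<Rightarrow> nat) i. if i < n then real (z i) / real p else c i)"
  have pt: "pt z \<in> cube n c" if "\<And>i. i < n \<Longrightarrow> z i \<le> p" for z
    using that p(1) unfolding pt_def cube_def by (simp add: divide_le_eq)
  define label where "label = (\<lambda>z m. if pt z m = 0 then 0 else if pt z m = 1 then 1
      else if pt z \<in> W m then 0 else 1::nat)"
  obtain q where q: "\<forall>i<n. q i < p"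
    "\<forall>i<n. \<exists>r s. (\<forall>j<n. q j \<le> r j \<and> r j \<le> q j + 1) \<and> (\<forall>j<n. q j \<le> s j \<and> s j \<le> q j + 1) \<and>
      label r i \<noteq> label s i"
    by (rule kuhn_lemma[of p n label]) (use p(1) in \<open>auto simp: label_def pt_def\<close>)
  have "pt q \<in> cube n c" using q(1) by (intro pt) (simp add: less_imp_le)
  then obtain G where G: "G \<in> \<G>" "ball (pt q) \<epsilon> \<subseteq> G" using \<epsilon>(2) by blast
  then obtain m where m: "m < n" "G = W m \<or> G = R m" unfolding \<G>_def by blast
  have near: "pt r \<in> G \<inter> cube n c" if r: "\<forall>j<n. q j \<le> r j \<and> r j \<le> q j + 1" for r
  proof
    have "dist (pt q i) (pt r i) \<le> 1 / real p" for i
    proof (cases "i < n")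
      case True
      then have "\<bar>real (q i) - real (r i)\<bar> \<le> 1" using r by force
      then have "\<bar>real (q i) - real (r i)\<bar> / real p \<le> 1 / real p" by (intro divide_right_mono) auto
      then show ?thesis using True p(1)
        by (simp add: pt_def dist_real_def diff_divide_distrib[symmetric] abs_divide)
    qed (simp add: pt_def)
    then have "dist (pt q) (pt r) \<le> 2 * (1 / real p)" by (rule dist_fun_le)
    then show "pt r \<in> G" using p(2) G(2) by auto
    have "r i \<le> p" if "i < n" for i using r q(1) that by fastforce
    then show "pt r \<in> cube n c" by (rule pt)
  qed
  have const: "\<exists>b. \<forall>x \<in> G \<inter> cube n c. (if x m = 0 then 0 else if x m = 1 then 1
      else if x \<in> W m then 0 else 1::nat) = b"
    using m(2)
  proof
    assume "G = W m"
    then show ?thesis using W1[OF m(1)] by (intro exI[of _ 0]) auto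
  next
    assume "G = R m"
    then show ?thesis using R0[OF m(1)] disj[OF m(1)] by (intro exI[of _ 1]) auto
  qed
  then obtain b where "\<And>z. pt z \<in> G \<inter> cube n c \<Longrightarrow> label z m = b" unfolding label_def by blast
  then show False using q(2)[rule_format, OF m(1)] near by metis
qed

text \<open>
  Cover the cube by sets too small to meet both of the hyperplanes \<open>x m = 0\<close> and \<open>x m = 1\<close>. If
  \<open>n\<close> disjoint families suffice, assign the \<open>m\<close>-th one to the direction \<open>m\<close>, and split it into
  the sets that meet the first hyperplane and those that do not.
\<close>

lemma not_cover_order_le_cube: "\<not> cover_order_le (cube n c) n"
proof
  assume ord: "cover_order_le (cube n c) n"
  define B where "B = (\<lambda>a::nat \<Rightarrow> real. {x. \<forall>i\<in>{..<n}. x i \<in> ball (a i) (1/2)})"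
  have oB: "open (B a)" for a
    unfolding B_def by (intro product_topology_basis'[where x = "\<lambda>i. i"]) auto
  have opp: "False" if "m < n" "x \<in> B a" "y \<in> B a" "x m = 0" "y m = 1" for m x y a
  proof -
    have "dist (a m) (x m) < 1/2" "dist (a m) (y m) < 1/2"
      using that(1-3) unfolding B_def by (simp_all only: mem_Collect_eq mem_ball lessThan_iff Ball_def)
    then show False using that(4,5) unfolding dist_real_def by argo
  qed
  have "cube n c \<subseteq> (\<Union>a\<in>cube n c. B a)" by (auto simp: B_def)
  then obtain D where D: "finite D" "cube n c \<subseteq> (\<Union>a\<in>D. B a)"
    by (rule compactE_image[OF compact_cube oB])
  obtain N :: nat and a where a: "D = a ` {i. i < N}"
    using finite_imp_nat_seg_image_inj_on[OF D(1)] by blast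
  have "cube n c \<subseteq> (\<Union>i<N. B (a i))" using D(2) a by auto
  then obtain \<D> where \<D>: "\<And>m E. E \<in> \<D> m \<Longrightarrow> open E \<and> (\<exists>i<N. E \<subseteq> B (a i))"
    "\<And>m. disjoint (\<D> m)" "cube n c \<subseteq> (\<Union>m<n. \<Union>(\<D> m))"
    using cover_order_le_disjoint_families[OF ord, of N "\<lambda>i. B (a i)"] oB by metis
  \<comment> \<open>A set may meet the hyperplane outside the cube only; the smallness of the sets still keeps it
    off the opposite one.\<close>
  define W where "W = (\<lambda>m. \<Union>{E \<in> \<D> m. \<exists>x\<in>E. x m = 0})"
  define R where "R = (\<lambda>m. \<Union>{E \<in> \<D> m. \<not> (\<exists>x\<in>E. x m = 0)})"
  show False
  proof (rule cube_no_separating_cover[of n W R c])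
    show "open (W m)" "open (R m)" for m
      unfolding W_def R_def using \<D>(1) by (auto intro!: open_Union)
    show "W m \<inter> R m \<inter> cube n c = {}" for m
      using \<D>(2)[of m] unfolding W_def R_def pairwise_def disjnt_def by blast
    show "x m \<noteq> 1" if "m < n" "x \<in> W m \<inter> cube n c" for m x
      using that opp[OF that(1)] \<D>(1)[of _ m] unfolding W_def by blast
    show "x m \<noteq> 0" if "m < n" "x \<in> R m \<inter> cube n c" for m x
      using that unfolding R_def by blast
    have "{E \<in> \<D> m. \<exists>x\<in>E. x m = 0} \<union> {E \<in> \<D> m. \<not> (\<exists>x\<in>E. x m = 0)} = \<D> m" for m
      by fastforce
    then have "W m \<union> R m = \<Union>(\<D> m)" for m
      unfolding W_def R_def Union_Un_distrib[symmetric] by (rule arg_cong)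
    then show "cube n c \<subseteq> (\<Union>m<n. W m \<union> R m)" using \<D>(3) by (simp only:)
  qed
qed

section \<open>The dimension of a cube is at most its number of coordinates\<close>

text \<open>
  A set whose points have few coordinates outside a countable set \<open>Z\<close> is low-dimensional. Take
  boxes with corners outside \<open>Z\<close>: a point on the frontier of such a box has a corner coordinate,
  so adding the finitely many corner coordinates to \<open>Z\<close> leaves it with one coordinate fewer
  outside. The varying \<open>Z\<close> thus replaces a sum theorem for the faces of the box.
\<close>

lemma dim_le_few_coordinates_outside_countable:
  fixes Z :: "real set" and S :: "(nat \<Rightarrow> real) set"
  assumes "countable Z"
    and "\<And>x. x \<in> S \<Longrightarrow> (\<forall>i\<ge>n. x i = c i) \<and> card {i. i < n \<and> x i \<notin> Z} < m"
  shows "top_of_set S dim_le (int m - 1)"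
  using assms
proof (induction m arbitrary: S Z)
  case 0
  then have "S = {}" by blast
  then show ?case by simp
next
  case (Suc m)
  show ?case
  proof (rule iffD2[OF dim_le_subset_iff], intro conjI allI impI, goal_cases)
    case 1 show ?case by simp
  next
    case (2 V a)
    then have V: "open V" "a \<in> V" "a \<in> S" by auto
    then obtain \<epsilon> where \<epsilon>: "\<epsilon> > 0" "ball a \<epsilon> \<subseteq> V" by (meson openE)
    \<comment> \<open>Side lengths below \<open>\<epsilon> / 2\<close> keep the points of \<open>S\<close> in the closed box inside \<open>V\<close>, since the
      distance of two points is at most twice their largest coordinate distance.\<close>
    have "\<exists>l. a i - \<epsilon> / 4 < l \<and> l < a i \<and> l \<notin> Z" for i
      using open_minus_countable[OF Suc.prems(1), of "{a i - \<epsilon> / 4<..<a i}"] \<epsilon>(1) by auto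
    then obtain l where l: "\<And>i. a i - \<epsilon> / 4 < l i \<and> l i < a i \<and> l i \<notin> Z" by metis
    have "\<exists>h. a i < h \<and> h < a i + \<epsilon> / 4 \<and> h \<notin> Z" for i
      using open_minus_countable[OF Suc.prems(1), of "{a i<..<a i + \<epsilon> / 4}"] \<epsilon>(1) by auto
    then obtain h where h: "\<And>i. a i < h i \<and> h i < a i + \<epsilon> / 4 \<and> h i \<notin> Z" by metis
    define B where "B = {x. \<forall>i\<in>{..<n}. x i \<in> {l i<..<h i}}"
    have oB: "open B"
      unfolding B_def by (intro product_topology_basis'[where x = "\<lambda>i. i"]) auto
    have near: "x \<in> V" if x: "x \<in> S" "\<And>i. i < n \<Longrightarrow> l i \<le> x i \<and> x i \<le> h i" for x
    proof -
      have "dist (a i) (x i) \<le> \<epsilon> / 4" for i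
      proof (cases "i < n")
        case True
        then show ?thesis using x(2)[OF True] l[of i] h[of i] unfolding dist_real_def by argo
      next
        case False
        then have "a i = x i" using Suc.prems(2)[OF V(3)] Suc.prems(2)[OF x(1)] by simp
        then show ?thesis using \<epsilon>(1) by simp
      qed
      then have "dist a x \<le> 2 * (\<epsilon> / 4)" by (rule dist_fun_le)
      then show ?thesis using \<epsilon> by auto
    qed
    let ?Z = "Z \<union> l ` {..<n} \<union> h ` {..<n}"
    let ?F = "S \<inter> closure (S \<inter> (B \<inter> V)) - (B \<inter> V)"
    have "top_of_set ?F dim_le (int m - 1)"
    proof (rule Suc.IH)
      show "countable ?Z" using Suc.prems(1) by auto
      fix x assume x: "x \<in> ?F"
      have closed_box: "closed {x. l i \<le> x i \<and> x i \<le> h i}" for i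
        by (intro closed_Collect_conj closed_Collect_le continuous_intros) auto
      have "l i \<le> x i \<and> x i \<le> h i" if "i < n" for i
      proof -
        have "S \<inter> (B \<inter> V) \<subseteq> {x. l i \<le> x i \<and> x i \<le> h i}" using that unfolding B_def by force
        then have "closure (S \<inter> (B \<inter> V)) \<subseteq> {x. l i \<le> x i \<and> x i \<le> h i}"
          using closed_box by (rule closure_minimal)
        then show ?thesis using x by blast
      qed
      moreover from this have "x \<in> V" using near x by blast
      ultimately obtain i where i: "i < n" "x i = l i \<or> x i = h i"
        using x unfolding B_def by (force simp: order_le_less)
      have "{j. j < n \<and> x j \<notin> ?Z} \<subset> {j. j < n \<and> x j \<notin> Z}"
      proof
        show "{j. j < n \<and> x j \<notin> ?Z} \<subseteq> {j. j < n \<and> x j \<notin> Z}" by auto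
        have "x i \<notin> Z" "x i \<in> ?Z" using i l h by auto
        then show "{j. j < n \<and> x j \<notin> ?Z} \<noteq> {j. j < n \<and> x j \<notin> Z}" using i(1) by blast
      qed
      then have "card {j. j < n \<and> x j \<notin> ?Z} < card {j. j < n \<and> x j \<notin> Z}"
        by (intro psubset_card_mono) auto
      then show "(\<forall>i\<ge>n. x i = c i) \<and> card {j. j < n \<and> x j \<notin> ?Z} < m"
        using Suc.prems(2)[of x] x by force
    qed
    moreover have "a \<in> B" unfolding B_def using l h by auto
    ultimately show ?case using V oB by (intro exI[of _ "B \<inter> V"]) auto
  qed
qed

lemma cube_dim_le: "top_of_set (cube n c) dim_le int n"
proof -
  have "card {i. i < n \<and> x i \<notin> {}} < Suc n" for x :: "nat \<Rightarrow> real" by simp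
  then have "top_of_set (cube n c) dim_le (int (Suc n) - 1)"
    by (intro dim_le_few_coordinates_outside_countable[of "{}" _ n c]) (auto simp: cube_def)
  then show ?thesis by simp
qed

lemma top_dim_cube: "top_dim (top_of_set (cube n c)) = ereal (real n)"
proof -
  have "\<not> top_of_set (cube n c) dim_le (int n - 1)"
    using dim_le_imp_cover_order_le[OF compact_cube] not_cover_order_le_cube by blast
  then show ?thesis
    using top_dim_eq_int_iff[of "top_of_set (cube n c)" "int n"] cube_dim_le by simp
qed

section \<open>Products of vertical and horizontal sets in the jet group\<close>

lemma top_dim_homeomorphic_space:
  assumes "X homeomorphic_space Y"
  shows "top_dim X = top_dim Y"
  unfolding top_dim_def using homeomorphic_space_dimension_le[OF assms] by simp

text \<open>The first coordinate of a jet recovers its base point, continuously.\<close>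

lemma top_dim_jet_segment:
  assumes "smooth f"
  shows "top_dim (top_of_set (jet k f ` {0..1})) = ereal 1"
proof -
  define g where "g = (\<lambda>p::nat \<Rightarrow> real. \<lambda>i::nat. if i = 0 then p (k + 1) else 0)"
  have base: "x (0::nat) \<in> {0..1}" if "x \<in> cube 1 (\<lambda>_. 0)" for x
    using that by (simp add: cube_def)
  have "continuous_on UNIV (\<lambda>x. jet k f x s)" for s
    using assms differentiable_imp_continuous_on[of "(deriv ^^ s) f" UNIV]
    unfolding jet_def smooth_def by (cases "s = k + 1"; cases "s \<le> k") (auto intro: continuous_intros)
  then have "continuous_on UNIV (jet k f)"
    by (rule continuous_on_coordinatewise_then_product)
  then have "continuous_on (cube 1 (\<lambda>_. 0)) (\<lambda>x. jet k f (x 0))"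
    by (rule continuous_on_compose2)
       (auto intro: continuous_on_subset[OF continuous_on_product_coordinates])
  moreover have "continuous_on (jet k f ` {0..1}) (\<lambda>p. g p i)" for i
    unfolding g_def
    by (cases "i = 0") (auto intro: continuous_on_subset[OF continuous_on_product_coordinates])
  then have "continuous_on (jet k f ` {0..1}) g"
    by (rule continuous_on_coordinatewise_then_product)
  moreover have "(\<lambda>x. jet k f (x 0)) ` cube 1 (\<lambda>_. 0) \<subseteq> jet k f ` {0..1}"
    using base by blast
  moreover have "g ` jet k f ` {0..1} \<subseteq> cube 1 (\<lambda>_. 0)"
    by (auto simp: g_def jet_def cube_def)
  moreover have "g (jet k f (x 0)) = x" if "x \<in> cube 1 (\<lambda>_. 0)" for x
    using that by (auto simp: g_def jet_def cube_def fun_eq_iff)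
  moreover have "jet k f (g p 0) = p" if "p \<in> jet k f ` {0..1}" for p
    using that by (auto simp: g_def jet_def)
  ultimately have "homeomorphic_maps (top_of_set (cube 1 (\<lambda>_. 0))) (top_of_set (jet k f ` {0..1}))
      (\<lambda>x. jet k f (x 0)) g"
    unfolding homeomorphic_maps_def by (auto simp: continuous_map_in_subtopology)
  then show ?thesis
    using top_dim_homeomorphic_space top_dim_cube[of 1 "\<lambda>_. 0"]
    unfolding homeomorphic_space_def by (metis of_nat_1)
qed

lemma horizontal_set_exists:
  assumes "smooth f" "a \<in> {0, 1::nat}"
  obtains X where "X \<noteq> {}" "top_dim (top_of_set (jet k f ` X)) = ereal (real a)"
proof (cases "a = 0")
  case True
  have "jet k f ` {0} = cube 0 (jet k f 0)" by (auto simp: cube_def)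
  then show thesis using that[of "{0}"] top_dim_cube[of 0 "jet k f 0"] True by simp
next
  case False
  then show thesis using that[of "{0..1}"] top_dim_jet_segment[OF assms(1)] assms(2) by simp
qed

text \<open>
  The first coordinate of the product \<open>v \<odot> j\<^sup>k\<^sub>x(f)\<close> is \<open>t + x\<close>, so the base point \<open>x\<close>, and with
  it both factors, can be read off from the product.
\<close>

lemma vertical_horizontal_of_product:
  fixes f :: "real \<Rightarrow> real" and x :: real
  assumes v: "v \<in> jet_space k" "v (k + 1) = t"
  defines "p \<equiv> v \<otimes>\<^bsub>jet_group k\<^esub> jet k f x"
  shows "p \<in> jet_space k" "horizontal_map k f t p = jet k f x" "vertical_map k f t p = v"
proof -
  interpret group "jet_group k" by (rule group_jet_group)
  have carr: "carrier (jet_group k) = jet_space k" by (simp add: jet_group_def)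
  have vj: "v \<in> carrier (jet_group k)" "jet k f x \<in> carrier (jet_group k)"
    using v jet_in_jet_space carr by simp_all
  then show "p \<in> jet_space k" unfolding p_def carr[symmetric] by simp
  have "p (k + 1) = t + x" using v by (simp add: p_def jet_group_def jet_mult_def jet_def)
  then have x: "p (k + 1) - t = x" by simp
  then show "horizontal_map k f t p = jet k f x" by (simp add: horizontal_map_def)
  show "vertical_map k f t p = v"
    unfolding vertical_map_def x unfolding p_def using vj by (simp add: m_assoc)
qed

lemma subtopology_Euclidean_space_eq_top_of_set:
  assumes "A \<subseteq> topspace (Euclidean_space n)"
  shows "subtopology (Euclidean_space n) A = top_of_set A"
proof -
  have "{x. \<forall>i\<ge>n. x i = 0} \<inter> A = A" using assms by (auto simp: topspace_Euclidean_space)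
  then show ?thesis
    by (simp add: Euclidean_space_def subtopology_subtopology euclidean_product_topology)
qed

theorem proposition6p1:
  fixes k :: nat and f :: "real \<Rightarrow> real" and t :: real
  assumes "k \<ge> 1" and "smooth f"
  shows "\<forall>a \<in> {0, 1::nat}. \<forall>b \<in> {0..k + 1}.
    \<exists>E \<subseteq> jet_space k.
      top_dim (subtopology (Euclidean_space (k + 2)) (horizontal_map k f t ` E)) = ereal (real a) \<and>
      top_dim (subtopology (Euclidean_space (k + 2)) (vertical_map k f t ` E)) = ereal (real b)"
proof (intro ballI)
  fix a b :: nat assume a: "a \<in> {0, 1}" and b: "b \<in> {0..k + 1}"
  obtain X where X: "X \<noteq> {}" "top_dim (top_of_set (jet k f ` X)) = ereal (real a)"
    using horizontal_set_exists[OF assms(2) a] by blast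
  let ?c = "\<lambda>i. if i = k + 1 then t else 0"
  let ?K = "cube b ?c"
  let ?E = "(\<lambda>(v, x). v \<otimes>\<^bsub>jet_group k\<^esub> jet k f x) ` (?K \<times> X)"
  have K: "v \<in> jet_space k" "v (k + 1) = t" if "v \<in> ?K" for v
    using that b unfolding jet_space_iff cube_def by auto
  have prod: "v \<otimes>\<^bsub>jet_group k\<^esub> jet k f x \<in> jet_space k"
    "horizontal_map k f t (v \<otimes>\<^bsub>jet_group k\<^esub> jet k f x) = jet k f x"
    "vertical_map k f t (v \<otimes>\<^bsub>jet_group k\<^esub> jet k f x) = v" if "v \<in> ?K" for v x
    using vertical_horizontal_of_product[OF K[OF that]] by blast+
  have E: "?E \<subseteq> jet_space k" using prod(1) by auto
  have "horizontal_map k f t ` ?E = (\<lambda>(v, x). jet k f x) ` (?K \<times> X)"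
    unfolding image_image by (intro image_cong) (auto simp: prod(2))
  also have "\<dots> = jet k f ` X" using cube_nonempty by force
  finally have H: "horizontal_map k f t ` ?E = jet k f ` X" .
  have "vertical_map k f t ` ?E = (\<lambda>(v, x). v) ` (?K \<times> X)"
    unfolding image_image by (intro image_cong) (auto simp: prod(3))
  also have "\<dots> = ?K" using X(1) by force
  finally have V: "vertical_map k f t ` ?E = ?K" .
  have "jet k f ` X \<subseteq> jet_space k" "?K \<subseteq> jet_space k"
    using jet_in_jet_space K(1) by blast+
  then have "top_dim (subtopology (Euclidean_space (k + 2)) (horizontal_map k f t ` ?E)) = ereal (real a)"
    "top_dim (subtopology (Euclidean_space (k + 2)) (vertical_map k f t ` ?E)) = ereal (real b)"
    unfolding H V by (simp_all only: subtopology_Euclidean_space_eq_top_of_set X(2) top_dim_cube)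
  with E show "\<exists>E \<subseteq> jet_space k.
      top_dim (subtopology (Euclidean_space (k + 2)) (horizontal_map k f t ` E)) = ereal (real a) \<and>
      top_dim (subtopology (Euclidean_space (k + 2)) (vertical_map k f t ` E)) = ereal (real b)"
    by blast
qed

end
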